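(* Every multilinear quasi-identity of $M_n$ of degree $n$ in $x_1,\dots,x_n$ is a scalar multiple (by an element of $F$) of the Cayley–Hamilton polynomial $Q_n$.
   Context: $F$ is a field of characteristic $0$, $M_n=M_n(F)$, $\mathcal C=F[x^{(k)}_{ij}]$, quasi-polynomials are elements of the free $\mathcal C$-algebra on noncommuting $x_1,x_2,\dots$; a quasi-identity vanishes upon substituting any $A_k=(a^{(k)}_{ij})\in M_n$ for $x_k$ and $a^{(k)}_{ij}$ for $x^{(k)}_{ij}$. A quasi-polynomial $P(x_1,\dots,x_n)$ is multilinear of degree $n$ if it is a sum of terms $\lambda(x_{i_1},\dots,x_{i_k})x_{i_{k+1}}\cdots x_{i_n}$ where $\{1,\dots,n\}$ is the disjoint union of $\{i_1,\dots,i_k\}$ and $\{i_{k+1},\dots,i_n\}$ and $\lambda$ is an $F$-linear combination of products $x^{(i_1)}_{s_1t_1}\cdots x^{(i_k)}_{s_kt_k}$. With generic matrices $\xi_k=(x^{(k)}_{ij})$ and $\mathrm{tr}(x_{i_1}\cdots x_{i_r}):=\mathrm{tr}(\xi_{i_1}\cdots\xi_{i_r})$, $Q_n=\sum_{\sigma\in S_{n+1}}\epsilon_\sigma\phi_\sigma(x_1,\dots,x_n)$, where for $\sigma=(i_1,\dots,i_{k_1})\cdots(u_1,\dots,u_h)(s_1,\dots,s_k,n+1)$ (disjoint cycles, the one containing $n+1$ last) $\phi_\sigma=\mathrm{tr}(x_{i_1}\cdots x_{i_{k_1}})\cdots\mathrm{tr}(x_{u_1}\cdots x_{u_h})x_{s_1}\cdots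 x_{s_k}$. *)

theory Defs
  imports "HOL-Library.Poly_Mapping" "HOL-Combinatorics.Permutations" "Jordan_Normal_Form.Matrix"
begin

text \<open>Conventions (0-based): noncommuting variables x_0,...,x_{n-1} (paper: x_1..x_n);
  commuting variables x^(k)_(i,j) are encoded as the triple (k,i,j), with matrix indices
  i,j < n. The role of the paper's index n+1 in Q_n is played by n, so permutations are
  of the set {..n} = {0,...,n}.\<close>

type_synonym cvar = "nat \<times> nat \<times> nat"
type_synonym 'a cpoly = "(cvar \<Rightarrow>\<^sub>0 nat) \<Rightarrow>\<^sub>0 'a"   \<comment> \<open>the commutative ring C = F[x^(k)_ij]\<close>
type_synonym 'a qpoly = "nat list \<Rightarrow>\<^sub>0 'a cpoly"        \<comment> \<open>free C-algebra on noncommuting x_k: C-combinations of words\<close>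

definition cvarp :: "cvar \<Rightarrow> 'a::comm_ring_1 cpoly" where
  "cvarp v = Poly_Mapping.single (Poly_Mapping.single v 1) 1"

definition cconst :: "'a::comm_ring_1 \<Rightarrow> 'a cpoly" where
  "cconst c = Poly_Mapping.single 0 c"

definition ceval :: "(cvar \<Rightarrow> 'a::comm_ring_1) \<Rightarrow> 'a cpoly \<Rightarrow> 'a" where
  "ceval a p = (\<Sum>m\<in>Poly_Mapping.keys p. Poly_Mapping.lookup p m * (\<Prod>v\<in>Poly_Mapping.keys m. a v ^ Poly_Mapping.lookup m v))"

definition wprod :: "nat \<Rightarrow> (nat \<Rightarrow> 'a::comm_ring_1 mat) \<Rightarrow> nat list \<Rightarrow> 'a mat" where
  "wprod n As w = foldr (\<lambda>k M. As k * M) w (1\<^sub>m n)"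

definition qeval :: "nat \<Rightarrow> (nat \<Rightarrow> 'a::comm_ring_1 mat) \<Rightarrow> 'a qpoly \<Rightarrow> 'a mat" where
  "qeval n As P = mat n n (\<lambda>(i,j). \<Sum>w\<in>Poly_Mapping.keys P.
      ceval (\<lambda>(k,i,j). As k $$ (i,j)) (Poly_Mapping.lookup P w) * wprod n As w $$ (i,j))"

definition quasi_identity :: "nat \<Rightarrow> 'a::comm_ring_1 qpoly \<Rightarrow> bool" where
  "quasi_identity n P \<longleftrightarrow>
     (\<forall>As. (\<forall>k. As k \<in> carrier_mat n n) \<longrightarrow> qeval n As P = 0\<^sub>m n n)"

definition multilinear :: "nat \<Rightarrow> 'a::comm_ring_1 qpoly \<Rightarrow> bool" where
  "multilinear n P \<longleftrightarrow>
     (\<forall>w\<in>Poly_Mapping.keys P. distinct w \<and> set w \<subseteq> {..<n} \<and>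
        (\<forall>m\<in>Poly_Mapping.keys (Poly_Mapping.lookup P w). \<exists>f. (\<forall>i\<in>{..<n} - set w. f i \<in> {..<n} \<times> {..<n}) \<and>
            m = (\<Sum>i\<in>{..<n} - set w. Poly_Mapping.single (i, f i) 1)))"

text \<open>tr(x_{k_1}...x_{k_r}) = tr(xi_{k_1}...xi_{k_r}) for generic n x n matrices xi_k.\<close>
definition trp :: "nat \<Rightarrow> nat list \<Rightarrow> 'a::comm_ring_1 cpoly" where
  "trp n ks = (\<Sum>a\<in>{..<length ks} \<rightarrow>\<^sub>E {..<n}.
       \<Prod>j<length ks. cvarp (ks ! j, a j, a ((j + 1) mod length ks)))"

definition cyc :: "(nat \<Rightarrow> nat) \<Rightarrow> nat \<Rightarrow> nat set" where
  "cyc \<sigma> x = {(\<sigma> ^^ j) x | j. True}"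

definition cyc_list :: "(nat \<Rightarrow> nat) \<Rightarrow> nat \<Rightarrow> nat list" where
  "cyc_list \<sigma> x = map (\<lambda>j. (\<sigma> ^^ j) x) [0..<card (cyc \<sigma> x)]"

text \<open>phi_sigma for sigma a permutation of {..n}: the cycle through n is (s_1,...,s_k,n),
  giving the word s_1...s_k; every other cycle contributes a trace factor.\<close>
definition phi :: "nat \<Rightarrow> (nat \<Rightarrow> nat) \<Rightarrow> 'a::comm_ring_1 qpoly" where
  "phi n \<sigma> = Poly_Mapping.single (tl (cyc_list \<sigma> n))
      (\<Prod>Z\<in>{cyc \<sigma> x | x. x < n \<and> x \<notin> cyc \<sigma> n}. trp n (cyc_list \<sigma> (Min Z)))"

definition Qn :: "nat \<Rightarrow> 'a::comm_ring_1 qpoly" where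
  "Qn n = (\<Sum>\<sigma>\<in>{\<sigma>. \<sigma> permutes {..n}}. Poly_Mapping.map (\<lambda>p. of_int (sign \<sigma>) * p) (phi n \<sigma>))"

end

theory Submission
  imports Defs "HOL-Combinatorics.Cycles" "Jordan_Normal_Form.Determinant"
begin

text \<open>
  By multilinearity it suffices to evaluate at matrix units, that is, to read \<open>x_k\<close> as a directed
  edge \<open>p k \<rightarrow> q k\<close> on \<open>n\<close> vertices. A word then evaluates at position \<open>(i, j)\<close> to 1 or 0 according
  to whether it is a trail from \<open>i\<close> to \<open>j\<close>, and a multilinear quasi-identity becomes a system of linear
  equations: for every choice of \<open>n\<close> edges and all \<open>i, j\<close>, the coefficients \<open>c(w, remaining edges)\<close>
  summed over the trails \<open>w\<close> from \<open>i\<close> to \<open>j\<close> give 0.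

  Words of length \<open>n\<close> have equal coefficients: a path through all \<open>n\<close> vertices with a loop at one of
  them has exactly two trails between its ends, so inserting a letter anywhere gives the same value.
  If all these coefficients vanish, then so do all others, by induction on the number \<open>u > 0\<close> of edges
  outside \<open>w\<close>: these edges admit a level function onto \<open>{0..n-u}\<close> along which they never ascend, and
  if \<open>w\<close> is laid out as a path climbing one level per step, every other trail between its ends
  is longer. Hence the solution space is at most one-dimensional.

  Finally \<open>Q_n\<close> is a solution with coefficient \<open>\<plusminus>1\<close> at \<open>x_0 \<dots> x_{n-1}\<close>: closing up the trails by an
  additional edge \<open>j \<rightarrow> i\<close>, numbered \<open>n\<close>, turns the equation into the vanishing of the determinant of the
  \<open>(n+1) \<times> (n+1)\<close> matrix with entries \<open>[q k = p l]\<close>, which has two equal rows.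
\<close>

section \<open>Trails\<close>

fun trail :: "(nat \<Rightarrow> nat) \<Rightarrow> (nat \<Rightarrow> nat) \<Rightarrow> nat \<Rightarrow> nat list \<Rightarrow> nat \<Rightarrow> bool" where
  "trail p q i [] j \<longleftrightarrow> i = j"
| "trail p q i (k # w) j \<longleftrightarrow> p k = i \<and> trail p q (q k) w j"

definition words :: "nat \<Rightarrow> nat list set" where
  "words n = {w. distinct w \<and> set w \<subseteq> {..<n}}"

lemma finite_words: "finite (words n)"
  unfolding words_def using finite_subset_distinct[of "{..<n}"] by (simp add: conj_commute)

lemma length_words: "w \<in> words n \<Longrightarrow> length w \<le> n"
  unfolding words_def using card_mono[of "{..<n}" "set w"] by (auto simp: distinct_card)

lemma full_words: "w \<in> words n \<Longrightarrow> length w = n \<longleftrightarrow> set w = {..<n}"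
  unfolding words_def using card_subset_eq[of "{..<n}" "set w"]
  by (metis (no_types, lifting) card_lessThan distinct_card finite_lessThan mem_Collect_eq)

text \<open>Put a sink on the lowest level and recurse. When no sink is left, every vertex is the source of
  an edge, so there are at least as many edges as vertices and a single level is enough.\<close>

lemma ex_level_function:
  fixes p q :: "nat \<Rightarrow> nat"
  assumes "finite R" "finite U" "\<And>k. k \<in> U \<Longrightarrow> p k \<in> R"
  shows "\<exists>h s. h ` R = {..<s::nat} \<and> (\<forall>k\<in>U. q k \<in> R \<longrightarrow> h (q k) \<le> (h (p k) :: nat)) \<and>
    card R \<le> s + card U \<and> (U \<noteq> {} \<longrightarrow> card R < s + card U)"
  using assms
proof (induction "card R" arbitrary: R U)
  case 0
  then have "R = {}" by simp
  with 0 show ?case by (intro exI[of _ "\<lambda>_. 0"] exI[of _ 0]) auto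
next
  case (Suc m)
  show ?case
  proof (cases "\<exists>x\<in>R. \<forall>k\<in>U. p k = x \<longrightarrow> q k \<notin> R - {x}")
    case True
    then obtain x where x: "x \<in> R" "\<And>k. k \<in> U \<Longrightarrow> p k = x \<Longrightarrow> q k \<notin> R - {x}" by blast
    define R' where "R' = R - {x}"
    \<comment> \<open>Edges from other vertices into \<open>x\<close> are kept: \<open>x\<close>
      gets level 0 below everything else, so they never ascend.\<close>
    define U' where "U' = {k \<in> U. p k \<noteq> x}"
    have cR: "card R = Suc (card R')" using card_Suc_Diff1[of R x] x Suc.prems by (simp add: R'_def)
    have "\<exists>h s. h ` R' = {..<s::nat} \<and> (\<forall>k\<in>U'. q k \<in> R' \<longrightarrow> h (q k) \<le> (h (p k) :: nat)) \<and>
      card R' \<le> s + card U' \<and> (U' \<noteq> {} \<longrightarrow> card R' < s + card U')"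
      using Suc.prems Suc.hyps cR by (intro Suc.hyps(1)) (auto simp: R'_def U'_def)
    then obtain h s where h: "h ` R' = {..<s}" "\<forall>k\<in>U'. q k \<in> R' \<longrightarrow> h (q k) \<le> (h (p k) :: nat)"
      "card R' \<le> s + card U'" "U' \<noteq> {} \<longrightarrow> card R' < s + card U'" by blast
    define g where "g = (\<lambda>y. if y = x then 0 else Suc (h y))"
    have "g ` R = insert 0 (Suc ` h ` R')"
      using x by (auto simp: g_def R'_def image_image)
    then have "g ` R = {..<Suc s}" by (simp add: h lessThan_Suc_eq_insert_0)
    moreover have "\<forall>k\<in>U. q k \<in> R \<longrightarrow> g (q k) \<le> g (p k)"
      using h(2) x(2) by (auto simp: g_def R'_def U'_def)
    moreover have "card U' \<le> card U" using Suc.prems by (intro card_mono) (auto simp: U'_def)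
    \<comment> \<open>If no edge is left for the induction hypothesis, an edge discarded together
      with \<open>x\<close> supplies the strict bound.\<close>
    moreover have "card U' < card U" if "U \<noteq> {}" "U' = {}"
      using that Suc.prems by (simp add: card_gt_0_iff)
    ultimately show ?thesis using h(3,4) cR
      by (intro exI[of _ g] exI[of _ "Suc s"]) (cases "U' = {}"; fastforce)
  next
    case False
    then have "\<exists>k\<in>U. p k = x" if "x \<in> R" for x using that by blast
    then have "R \<subseteq> p ` U" by blast
    then have "card R \<le> card U" using Suc.prems by (meson card_image_le card_mono finite_imageI le_trans)
    moreover have "R \<noteq> {}" using Suc.hyps by auto
    ultimately show ?thesis
      by (intro exI[of _ "\<lambda>_. 0"] exI[of _ 1]) auto
  qed
qed

section \<open>Climbing bounds for trails against a level function\<close>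

lemma level_le_trail:
  assumes "trail p q i w j" "\<And>k. k \<in> set w \<Longrightarrow> h (q k) \<le> Suc (h (p k))"
  shows "h j \<le> h i + length w"
  using assms
proof (induction w arbitrary: i)
  case (Cons k w)
  then have "h j \<le> h (q k) + length w" by auto
  moreover have "h (q k) \<le> Suc (h i)" using Cons.prems by auto
  ultimately show ?case by simp
qed simp

text \<open>The trail has to reach level \<open>length w\<close> in at most
  \<open>length w - h i\<close> steps, and no edge climbs more than one level, so every step must
  climb. Only letters of \<open>w\<close> climb, one from each level below
  \<open>length w\<close>.\<close>

lemma trail_unique_if_short:
  assumes "trail p q i w' j" "set w' \<subseteq> {..<n}"
    and "h j = length w" "h i + length w' \<le> length w"
    and up: "\<And>a. a < length w \<Longrightarrow> h (p (w ! a)) = a \<and> h (q (w ! a)) = Suc a"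
    and down: "\<And>k. k < n \<Longrightarrow> k \<notin> set w \<Longrightarrow> h (q k) \<le> h (p k)"
  shows "w' = drop (h i) w"
  using assms(1-4)
proof (induction w' arbitrary: i)
  case (Cons k w')
  have step: "h (q l) \<le> Suc (h (p l))" if "l < n" for l
    using up down that by (metis in_set_conv_nth le_SucI order_refl)
  have "h j \<le> h (q k) + length w'"
    using Cons.prems step by (intro level_le_trail[of p q]) auto
  \<comment> \<open>The rest \<open>w'\<close> is too short to make up for a first step that does
    not climb.\<close>
  then have q: "Suc (h i) \<le> h (q k)" using Cons.prems by simp
  moreover have i: "p k = i" "k < n" using Cons.prems by auto
  ultimately have "k \<in> set w" using down[of k] by force
  then obtain a where a: "a < length w" "k = w ! a" by (auto simp: in_set_conv_nth)
  with up i have ai: "a = h i" "h (q k) = Suc (h i)" by auto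
  with Cons.IH[of "q k"] Cons.prems have "w' = drop (Suc (h i)) w" by simp
  with a ai show ?case by (simp add: Cons_nth_drop_Suc)
qed simp

text \<open>Moves the ends of the edges in \<open>w\<close> to the vertices \<open>v 0, v 1, \<dots>\<close> and keeps the other edges.\<close>

definition path_ends :: "nat list \<Rightarrow> (nat \<Rightarrow> nat) \<Rightarrow> (nat \<Rightarrow> nat) \<Rightarrow> nat \<Rightarrow> nat" where
  "path_ends w v p k = (if k \<in> set w then v (THE a. a < length w \<and> w ! a = k) else p k)"

lemma path_ends_nth [simp]: "distinct w \<Longrightarrow> a < length w \<Longrightarrow> path_ends w v p (w ! a) = v a"
  unfolding path_ends_def by (auto simp: nth_eq_iff_index_eq intro!: arg_cong[of _ _ v] the_equality)

lemma path_ends_outside [simp]: "k \<notin> set w \<Longrightarrow> path_ends w v p k = p k"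
  by (simp add: path_ends_def)

lemma path_ends_less:
  assumes "distinct w" "\<And>a. a < length w \<Longrightarrow> v a < n" "k \<notin> set w \<Longrightarrow> p k < n"
  shows "path_ends w v p k < n"
  using assms by (cases "k \<in> set w") (auto simp: in_set_conv_nth)

lemma trail_along_path:
  assumes "distinct w" "a \<le> length w"
  shows "trail (path_ends w v p) (path_ends w (v \<circ> Suc) q) (v a) (drop a w) (v (length w))"
  using assms(2)
proof (induction rule: inc_induct)
  case (step a)
  then have "drop a w = w ! a # drop (Suc a) w" by (simp add: Cons_nth_drop_Suc)
  with step assms show ?case by simp
qed simp

lemma trail_append: "trail p q i (u @ w) j \<longleftrightarrow> (\<exists>l. trail p q i u l \<and> trail p q l w j)"
  by (induction u arbitrary: i) auto

text \<open>Only the linear equations are kept, so that they can be used for a difference of two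
  solutions. \<open>c w p q\<close> stands for the coefficient of \<open>w\<close> when each
  \<open>k\<close> is the edge from \<open>p k\<close> to \<open>q k\<close>; for a word containing
  all letters, \<open>coeff_local\<close> makes it independent of \<open>p\<close> and
  \<open>q\<close>.\<close>

locale trail_system =
  fixes n :: nat and c :: "nat list \<Rightarrow> (nat \<Rightarrow> nat) \<Rightarrow> (nat \<Rightarrow> nat) \<Rightarrow> 'a::comm_ring_1"
  assumes coeff_local: "w \<in> words n \<Longrightarrow> (\<And>k. k < n \<Longrightarrow> k \<notin> set w \<Longrightarrow> p k = p' k \<and> q k = q' k) \<Longrightarrow>
      c w p q = c w p' q'"
    and trails: "(\<And>k. k < n \<Longrightarrow> p k < n) \<Longrightarrow> (\<And>k. k < n \<Longrightarrow> q k < n) \<Longrightarrow> i < n \<Longrightarrow> j < n \<Longrightarrow>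
      (\<Sum>w\<in>{w \<in> words n. trail p q i w j}. c w p q) = 0"
begin

lemma zero_if_full_zero:
  assumes full: "\<And>w p q. w \<in> words n \<Longrightarrow> length w = n \<Longrightarrow> c w p q = 0"
    and "w \<in> words n" "\<And>k. k < n \<Longrightarrow> p k < n" "\<And>k. k < n \<Longrightarrow> q k < n"
  shows "c w p q = 0"
  using assms(2-)
proof (induction "n - length w" arbitrary: w p q rule: less_induct)
  case less
  have w: "distinct w" "set w \<subseteq> {..<n}" "length w \<le> n"
    using less.prems length_words by (auto simp: words_def)
  show ?case
  proof (cases "length w = n")
    case False
    define U where "U = {..<n} - set w"
    have cU: "card U + length w = n" using w by (simp add: U_def card_Diff_subset distinct_card)
    with False have "U \<noteq> {}" by auto
    \<comment> \<open>The strict bound gives \<open>s > n - card U = length w\<close>, so the levels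
      0 to \<open>length w\<close> are all inhabited.\<close>
    then obtain h s where h: "h ` {..<n} = {..<s}" "\<forall>k\<in>U. h (q k) \<le> (h (p k) :: nat)" "n < s + card U"
      using ex_level_function[of "{..<n}" U p q] less.prems unfolding U_def by auto
    define r where "r = length w"
    \<comment> \<open>Levels above \<open>r\<close> are merged into \<open>r\<close>; edges outside
      \<open>w\<close> still do not ascend.\<close>
    define g where "g = (\<lambda>x. min (h x) r)"
    have "r < s" using h(3) cU by (simp add: r_def)
    have "\<exists>x<n. g x = a" if "a \<le> r" for a
    proof -
      from that \<open>r < s\<close> have "a \<in> h ` {..<n}" by (simp add: h)
      with that show ?thesis by (auto simp: g_def)
    qed
    then obtain v where v: "\<And>a. a \<le> r \<Longrightarrow> v a < n \<and> g (v a) = a" by metis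
    \<comment> \<open>By \<open>coeff_local\<close>, relocating the letters of \<open>w\<close> does
      not change the coefficient of \<open>w\<close>.\<close>
    define p' where "p' = path_ends w v p"
    define q' where "q' = path_ends w (v \<circ> Suc) q"
    have lt: "p' k < n" "q' k < n" if "k < n" for k
      unfolding p'_def q'_def using that less.prems w v by (auto intro!: path_ends_less simp: r_def)
    have up: "g (p' (w ! a)) = a \<and> g (q' (w ! a)) = Suc a" if "a < length w" for a
      using that w v by (simp add: p'_def q'_def r_def)
    have down: "g (q' k) \<le> g (p' k)" if "k < n" "k \<notin> set w" for k
      using h(2)[rule_format, of k] that by (simp add: p'_def q'_def g_def U_def min_le_iff_disj)
    have tw: "trail p' q' (v 0) w (v r)"
      using trail_along_path[of w 0] w by (simp add: p'_def q'_def r_def)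
    \<comment> \<open>A trail no longer than \<open>w\<close> is \<open>w\<close> itself by the
      level argument; longer words are covered by the induction.\<close>
    have other: "c w' p' q' = 0" if "w' \<in> words n" "trail p' q' (v 0) w' (v r)" "w' \<noteq> w" for w'
    proof (cases "length w' \<le> length w")
      case True
      have "w' = drop (g (v 0)) w"
        using that True v up down
        by (intro trail_unique_if_short[of p' q' "v 0" w' "v r" n g w]) (auto simp: words_def r_def)
      with that v show ?thesis by simp
    next
      case False
      with less.hyps[of w'] that lt length_words[of w' n] show ?thesis by auto
    qed
    have "0 = (\<Sum>w'\<in>{w' \<in> words n. trail p' q' (v 0) w' (v r)}. c w' p' q')"
      using trails[of p' q' "v 0" "v r"] lt v by simp
    also have "\<dots> = (\<Sum>w'\<in>{w}. c w' p' q')"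
      using tw other less.prems by (intro sum.mono_neutral_right) (auto simp: finite_words)
    also have "\<dots> = c w p q"
      using less.prems by (auto intro!: coeff_local simp: p'_def q'_def)
    finally show ?thesis by simp
  qed (use full less.prems in auto)
qed

text \<open>Lay out \<open>u @ v\<close> as a path through all \<open>n\<close> vertices, with
  \<open>e\<close> a loop at the vertex where \<open>u\<close> ends. The only trails between the
  ends of the path are \<open>u @ v\<close> and \<open>u @ e # v\<close>, so their coefficients
  cancel. As the right-hand side depends on \<open>u @ v\<close> alone, the position of
  \<open>e\<close> is immaterial.\<close>

lemma insert_loop:
  assumes w: "u @ e # v \<in> words n" "length (u @ e # v) = n"
  shows "c (u @ e # v) p q = - c (u @ v) (\<lambda>_. 0) (\<lambda>_. 0)"
proof -
  define x where "x = u @ v"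
  define a where "a = length u"
  \<comment> \<open>The vertices are numbered so that the loop sits at vertex 0 wherever
    \<open>e\<close> is inserted; otherwise the coefficient of \<open>u @ v\<close> would be taken
    at a loop depending on \<open>a\<close>.\<close>
  define t where "t = Transposition.transpose 0 a"
  have n: "n = Suc (length x)" "a \<le> length x" using w by (auto simp: x_def a_def)
  have ex: "e \<notin> set x" "distinct x" and x: "x \<in> words n" using w by (auto simp: words_def x_def)
  have full: "set (u @ e # v) = {..<n}" using w full_words by blast
  then have kx: "k = e \<or> k \<in> set x" if "k < n" for k using that by (auto simp: x_def)
  have t: "t b < n" if "b \<le> length x" for b
    using that n by (auto simp: t_def Transposition.transpose_def)
  have n0: "0 < n" using n by simp
  have t_inj: "t b = t d \<longleftrightarrow> b = d" for b d
    unfolding t_def by (metis transpose_involutory)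
  have ta: "t a = 0" by (simp add: t_def)
  define p' where "p' = path_ends x t (\<lambda>_. 0)"
  define q' where "q' = path_ends x (t \<circ> Suc) (\<lambda>_. 0)"
  have lt: "p' k < n" "q' k < n" for k
    unfolding p'_def q'_def using ex t n0 by (auto intro!: path_ends_less)
  \<comment> \<open>As \<open>e\<close> is not a letter of \<open>x\<close>, the default ends 0 make
    it a loop at \<open>t a\<close>.\<close>
  have e: "p' e = 0" "q' e = 0" using ex by (auto simp: p'_def q'_def)
  have pq: "p' (x ! b) = t b" "q' (x ! b) = t (Suc b)" if "b < length x" for b
    using that ex by (auto simp: p'_def q'_def)
  have trx: "trail p' q' (t b) (drop b x) (t (length x))" if "b \<le> length x" for b
    using trail_along_path ex that unfolding p'_def q'_def by blast
  \<comment> \<open>Distinctness of \<open>y\<close> allows the loop to be used at most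
    once.\<close>
  have trail_cases: "y = drop b x \<or> (b \<le> a \<and> y = take (a - b) (drop b x) @ e # drop a x)"
    if "trail p' q' (t b) y (t (length x))" "b \<le> length x" "distinct y" "set y \<subseteq> {..<n}" for b y
    using that
  proof (induction y arbitrary: b)
    case Nil
    then show ?case by (simp add: t_inj)
  next
    case (Cons k y)
    show ?case
    proof (cases "k = e")
      case True
      then have "b = a" using Cons.prems e ta t_inj[of b a] by auto
      moreover have "trail p' q' (t a) y (t (length x))" using Cons.prems True e ta by auto
      then have "y = drop a x"
        using Cons.IH[of a] Cons.prems n True by auto
      ultimately show ?thesis using True by simp
    next
      case False
      then obtain d where d: "d < length x" "k = x ! d" using kx Cons.prems by (auto simp: in_set_conv_nth)
      with Cons.prems pq t_inj have "d = b" by auto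
      with d pq Cons.prems Cons.IH[of "Suc b"]
      have "y = drop (Suc b) x \<or> (Suc b \<le> a \<and> y = take (a - Suc b) (drop (Suc b) x) @ e # drop a x)" by simp
      moreover have "drop b x = k # drop (Suc b) x" using d \<open>d = b\<close> by (simp add: Cons_nth_drop_Suc)
      ultimately show ?thesis by (auto simp: take_Cons' Suc_diff_le)
    qed
  qed
  have split: "take a x = u" "drop a x = v" by (auto simp: x_def a_def)
  have "trail p' q' (t 0) x (t (length x))" using trx[of 0] by simp
  then obtain l where l: "trail p' q' (t 0) u l" "trail p' q' l v (t (length x))"
    unfolding x_def trail_append by blast
  have "l = 0"
  proof (rule ccontr)
    assume "l \<noteq> 0"
    show False
    proof (cases u rule: rev_cases)
      case Nil
      with l \<open>l \<noteq> 0\<close> ta show False by (simp add: a_def)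
    next
      case (snoc u' k)
      then have "length u' < length x" "x ! length u' = k" "Suc (length u') = a"
        by (auto simp: x_def a_def nth_append)
      then have "q' k = 0" using pq(2)[of "length u'"] ta by simp
      with l snoc \<open>l \<noteq> 0\<close> show False by (auto simp: trail_append)
    qed
  qed
  with l e have tre: "trail p' q' (t 0) (u @ e # v) (t (length x))" by (auto simp: trail_append)
  have "0 = (\<Sum>y\<in>{y \<in> words n. trail p' q' (t 0) y (t (length x))}. c y p' q')"
    using trails[of p' q' "t 0" "t (length x)"] lt t by simp
  also have "{y \<in> words n. trail p' q' (t 0) y (t (length x))} = {x, u @ e # v}"
    using trail_cases[of 0] trx[of 0] tre w x by (auto simp: split words_def)
  also have "(\<Sum>y\<in>\<dots>. c y p' q') = c x p' q' + c (u @ e # v) p' q'"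
    using ex by (subst sum.insert) (auto simp: x_def)
  \<comment> \<open>The only letter below \<open>n\<close> outside \<open>x\<close> is
    \<open>e\<close>, and both its ends are 0.\<close>
  also have "c x p' q' = c x (\<lambda>_. 0) (\<lambda>_. 0)"
    using x kx e by (intro coeff_local) auto
  also have "c (u @ e # v) p' q' = c (u @ e # v) p q"
    using w full by (intro coeff_local) auto
  finally show ?thesis by (simp add: x_def eq_neg_iff_add_eq_0 add.commute)
qed

text \<open>Deleting the letter \<open>x\<close> from its old or its new position leaves the same
  word, so \<open>insert_loop\<close> can move it anywhere. The prefix \<open>z\<close> holds the
  letters that stay fixed while the rest is rearranged.\<close>

lemma full_eq_if_mset_eq:
  assumes "z @ xs \<in> words n" "length (z @ xs) = n" "mset xs = mset ys"
  shows "c (z @ xs) p q = c (z @ ys) p q"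
  using assms
proof (induction xs arbitrary: z ys)
  case (Cons x xs)
  then have "x \<in> set ys" by (metis list.set_intros(1) mset_eq_setD)
  then obtain y1 y2 where y: "ys = y1 @ x # y2" by (auto simp: in_set_conv_decomp)
  then have m: "mset xs = mset (y1 @ y2)" using Cons.prems by simp
  have "mset (z @ x # xs) = mset (z @ x # y1 @ y2)" using m by simp
  then have w: "z @ x # y1 @ y2 \<in> words n" "length (z @ x # y1 @ y2) = n"
    using Cons.prems(1,2) unfolding words_def
    by (metis (no_types, lifting) mem_Collect_eq mset_eq_imp_distinct_iff mset_eq_setD, metis size_mset)
  then have w': "(z @ y1) @ x # y2 \<in> words n" "length ((z @ y1) @ x # y2) = n"
    by (auto simp: words_def)
  have "c (z @ x # xs) p q = c (z @ x # y1 @ y2) p q"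
    using Cons.IH[of "z @ [x]" "y1 @ y2"] Cons.prems m by simp
  also have "\<dots> = c (z @ y1 @ x # y2) p q"
    using insert_loop[OF w] insert_loop[OF w'] by simp
  finally show ?case by (simp add: y)
qed simp

lemma full_eq:
  assumes "w \<in> words n" "length w = n"
  shows "c w p q = c [0..<n] p q"
proof -
  have "mset w = mset [0..<n]"
    using assms full_words[OF assms(1)] set_eq_iff_mset_eq_distinct[of w "[0..<n]"]
    by (auto simp: words_def atLeast0LessThan)
  with full_eq_if_mset_eq[of "[]" w] assms show ?thesis by simp
qed

end

section \<open>Multilinear polynomials\<close>

abbreviation lookup where "lookup \<equiv> Poly_Mapping.lookup"
abbreviation keys where "keys \<equiv> Poly_Mapping.keys"
abbreviation single where "single \<equiv> Poly_Mapping.single"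

section \<open>Evaluation of commutative polynomials as a ring homomorphism\<close>

definition meval :: "(cvar \<Rightarrow> 'a::comm_ring_1) \<Rightarrow> (cvar \<Rightarrow>\<^sub>0 nat) \<Rightarrow> 'a" where
  "meval a m = (\<Prod>v\<in>keys m. a v ^ lookup m v)"

lemma meval_superset:
  assumes "finite S" "keys m \<subseteq> S"
  shows "meval a m = (\<Prod>v\<in>S. a v ^ lookup m v)"
  unfolding meval_def using assms by (intro prod.mono_neutral_left) (auto simp: in_keys_iff)

lemma meval_add: "meval a (m + m') = meval a m * meval a m'"
proof -
  let ?S = "keys m \<union> keys m'"
  have "meval a (m + m') = (\<Prod>v\<in>?S. a v ^ lookup (m + m') v)"
    by (rule meval_superset) (auto dest: subsetD[OF keys_add])
  also have "\<dots> = (\<Prod>v\<in>?S. a v ^ lookup m v) * (\<Prod>v\<in>?S. a v ^ lookup m' v)"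
    by (simp add: lookup_add power_add prod.distrib)
  also have "\<dots> = meval a m * meval a m'"
    by (simp add: meval_superset[symmetric])
  finally show ?thesis .
qed

lemma meval_zero [simp]: "meval a 0 = 1"
  by (simp add: meval_def)

lemma meval_single [simp]: "meval a (single v 1) = a v"
  by (simp add: meval_def)

lemma meval_sum: "finite I \<Longrightarrow> meval a (\<Sum>i\<in>I. f i) = (\<Prod>i\<in>I. meval a (f i))"
  by (induction I rule: finite_induct) (auto simp: meval_add)

lemma ceval_superset:
  assumes "finite S" "keys d \<subseteq> S"
  shows "ceval a d = (\<Sum>m\<in>S. lookup d m * meval a m)"
  unfolding ceval_def meval_def using assms by (intro sum.mono_neutral_left) (auto simp: in_keys_iff)

lemma ceval_zero [simp]: "ceval a 0 = 0"
  by (simp add: ceval_def)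

lemma ceval_add: "ceval a (d + d') = ceval a d + ceval a d'"
proof -
  let ?S = "keys d \<union> keys d'"
  have "ceval a (d + d') = (\<Sum>m\<in>?S. lookup (d + d') m * meval a m)"
    by (rule ceval_superset) (auto dest: subsetD[OF keys_add])
  also have "\<dots> = (\<Sum>m\<in>?S. lookup d m * meval a m) + (\<Sum>m\<in>?S. lookup d' m * meval a m)"
    by (simp add: lookup_add distrib_right sum.distrib)
  also have "\<dots> = ceval a d + ceval a d'"
    by (simp add: ceval_superset[symmetric])
  finally show ?thesis .
qed

lemma ceval_uminus: "ceval a (- d) = - ceval a d"
  using ceval_add[of a d "- d"] by (simp add: eq_neg_iff_add_eq_0 add.commute)

lemma ceval_diff: "ceval a (d - d') = ceval a d - ceval a d'"
  using ceval_add[of a "d - d'" d'] by simp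

lemma ceval_sum: "ceval a (\<Sum>i\<in>I. f i) = (\<Sum>i\<in>I. ceval a (f i))"
  by (induction I rule: infinite_finite_induct) (auto simp: ceval_add)

lemma ceval_single: "ceval a (single m c) = c * meval a m"
  by (subst ceval_superset[of "{m}"]) auto

lemma sum_monomials: "d = (\<Sum>m\<in>keys d. single m (lookup d m))"
  by (rule poly_mapping_eqI) (simp add: lookup_sum lookup_single when_def in_keys_iff)

lemma ceval_mult: "ceval a (d * d') = ceval a d * ceval a d'"
proof -
  have "d * d' = (\<Sum>m\<in>keys d. \<Sum>m'\<in>keys d'. single (m + m') (lookup d m * lookup d' m'))"
    by (subst sum_monomials[of d], subst sum_monomials[of d']) (simp add: sum_product mult_single)
  then have "ceval a (d * d') = (\<Sum>m\<in>keys d. \<Sum>m'\<in>keys d'. (lookup d m * meval a m) * (lookup d' m' * meval a m'))"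
    by (simp add: ceval_sum ceval_single meval_add mult_ac)
  then show ?thesis by (simp add: sum_product[symmetric] ceval_superset[OF finite_keys order_refl])
qed

lemma ceval_one [simp]: "ceval a 1 = 1"
  using ceval_single[of a 0 1] by simp

lemma ceval_prod: "ceval a (\<Prod>i\<in>I. f i) = (\<Prod>i\<in>I. ceval a (f i))"
  by (induction I rule: infinite_finite_induct) (auto simp: ceval_mult)

lemma ceval_cvarp [simp]: "ceval a (cvarp v) = a v"
  using meval_single[of a v] by (simp add: cvarp_def ceval_single)

lemma ceval_cconst [simp]: "ceval a (cconst c) = c"
  by (simp add: cconst_def ceval_single)

lemma ceval_sign [simp]: "ceval a (of_int (sign \<sigma>) * d) = of_int (sign \<sigma>) * ceval a d"
  by (simp add: sign_def ceval_uminus)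

section \<open>Polynomials multilinear in a set of indices, and their values at matrix units\<close>

definition multilinear_in :: "nat \<Rightarrow> nat set \<Rightarrow> 'a::comm_ring_1 cpoly \<Rightarrow> bool" where
  "multilinear_in n U d \<longleftrightarrow> (\<forall>m\<in>keys d. \<exists>f. (\<forall>i\<in>U. f i \<in> {..<n} \<times> {..<n}) \<and>
     m = (\<Sum>i\<in>U. single (i, f i) 1))"

lemma multilinear_in_0 [simp]: "multilinear_in n U 0"
  by (simp add: multilinear_in_def)

lemma multilinear_in_1 [simp]: "multilinear_in n {} 1"
  by (simp add: multilinear_in_def)

lemma multilinear_in_add:
  "multilinear_in n U d \<Longrightarrow> multilinear_in n U d' \<Longrightarrow> multilinear_in n U (d + d')"
  unfolding multilinear_in_def using keys_add[of d d'] by blast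

lemma multilinear_in_uminus: "multilinear_in n U d \<Longrightarrow> multilinear_in n U (- d)"
  unfolding multilinear_in_def by (simp add: in_keys_iff)

lemma multilinear_in_sum:
  "(\<And>i. i \<in> I \<Longrightarrow> multilinear_in n U (f i)) \<Longrightarrow> multilinear_in n U (\<Sum>i\<in>I. f i)"
  by (induction I rule: infinite_finite_induct) (auto intro: multilinear_in_add)

text \<open>The two choices of entries are glued along the disjoint index sets. Products of traces
  over disjoint cycles need this, hence the arbitrary index set in
  \<open>multilinear_in\<close>.\<close>

lemma multilinear_in_mult:
  assumes "multilinear_in n U d" "multilinear_in n V d'" "finite U" "finite V" "U \<inter> V = {}"
  shows "multilinear_in n (U \<union> V) (d * d')"
  unfolding multilinear_in_def
proof
  fix m assume "m \<in> keys (d * d')"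
  then obtain m1 m2 where m: "m1 \<in> keys d" "m2 \<in> keys d'" "m = m1 + m2"
    using keys_mult[of d d'] by blast
  obtain f g where f: "\<forall>i\<in>U. f i \<in> {..<n} \<times> {..<n}" "m1 = (\<Sum>i\<in>U. single (i, f i) 1)"
    and g: "\<forall>i\<in>V. g i \<in> {..<n} \<times> {..<n}" "m2 = (\<Sum>i\<in>V. single (i, g i) 1)"
    using assms(1,2) m(1,2) unfolding multilinear_in_def by blast
  let ?h = "\<lambda>i. if i \<in> U then f i else g i"
  have "(\<Sum>i\<in>V. single (i, g i) (1::nat)) = (\<Sum>i\<in>V. single (i, ?h i) 1)"
    using assms(5) by (intro sum.cong) auto
  then have "m = (\<Sum>i\<in>U \<union> V. single (i, ?h i) 1)"
    using assms(3-5) by (simp add: m f g sum.union_disjoint)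
  then show "\<exists>h. (\<forall>i\<in>U \<union> V. h i \<in> {..<n} \<times> {..<n}) \<and> m = (\<Sum>i\<in>U \<union> V. single (i, h i) 1)"
    using f(1) g(1) by (intro exI[of _ ?h]) auto
qed

lemma multilinear_in_prod:
  assumes "finite I" "\<And>i. i \<in> I \<Longrightarrow> multilinear_in n (U i) (f i)" "\<And>i. i \<in> I \<Longrightarrow> finite (U i)"
    and "\<And>i j. i \<in> I \<Longrightarrow> j \<in> I \<Longrightarrow> i \<noteq> j \<Longrightarrow> U i \<inter> U j = {}"
  shows "multilinear_in n (\<Union>i\<in>I. U i) (\<Prod>i\<in>I. f i)"
  using assms
proof (induction I rule: finite_induct)
  case (insert i I)
  have "U i \<inter> (\<Union>j\<in>I. U j) = {}" using insert.prems(3) insert.hyps by fastforce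
  with insert show ?case by (auto intro!: multilinear_in_mult)
qed simp

lemma multilinear_in_cvarp: "i < n \<Longrightarrow> j < n \<Longrightarrow> multilinear_in n {k} (cvarp (k, i, j))"
  unfolding multilinear_in_def cvarp_def by (auto intro!: exI[of _ "\<lambda>_. (i, j)"])

lemma multilinear_in_cconst_mult: "multilinear_in n U d \<Longrightarrow> multilinear_in n U (cconst c * d)"
  unfolding multilinear_in_def cconst_def mult_map_scale_conv_mult[symmetric]
  by (auto simp: in_keys_iff Poly_Mapping.map.rep_eq)

lemma multilinear_in_sign: "multilinear_in n U d \<Longrightarrow> multilinear_in n U (of_int (sign \<sigma>) * d)"
  by (simp add: sign_def multilinear_in_uminus)

text \<open>If the choices differ at \<open>i\<close>, the exponents of the variable
  \<open>(i, f i)\<close> differ.\<close>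

lemma single_edge_sum_inj:
  assumes "finite U" "(\<Sum>i\<in>U. single (i, f i) (1::nat)) = (\<Sum>i\<in>U. single (i, g i) 1)" "i \<in> U"
  shows "f i = g i"
proof (rule ccontr)
  assume "f i \<noteq> g i"
  have *: "lookup (\<Sum>i\<in>U. single (i, h i) (1::nat)) (i, f i) = (if h i = f i then 1 else 0)" for h
  proof -
    have "lookup (\<Sum>i\<in>U. single (i, h i) (1::nat)) (i, f i) = (\<Sum>k\<in>U. if k = i then if h k = f i then 1 else 0 else 0)"
      unfolding lookup_sum by (intro sum.cong) (auto simp: lookup_single when_def)
    with assms show ?thesis by simp
  qed
  from *[of f] *[of g] assms(2) \<open>f i \<noteq> g i\<close> show False by auto
qed

text \<open>A monomial has value 1 if it picks the entry \<open>(p k, q k)\<close> for every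
  \<open>k\<close> and 0 otherwise, so evaluation reads off one coefficient. The values of
  \<open>a\<close> are prescribed only at indices below \<open>n\<close>, so that \<open>a\<close>
  may come from the entries of matrices.\<close>

lemma ceval_multilinear_in:
  assumes "multilinear_in n U d" "finite U"
    and a: "\<And>k i j. k \<in> U \<Longrightarrow> i < n \<Longrightarrow> j < n \<Longrightarrow> a (k, i, j) = of_bool (p k = i \<and> q k = j)"
  shows "ceval a d = lookup d (\<Sum>k\<in>U. single (k, p k, q k) 1)" (is "_ = lookup d ?m")
proof -
  have "meval a m = of_bool (m = ?m)" if m: "m \<in> keys d" for m
  proof -
    obtain f where f: "\<forall>i\<in>U. f i \<in> {..<n} \<times> {..<n}" "m = (\<Sum>i\<in>U. single (i, f i) 1)"
      using assms(1) m unfolding multilinear_in_def by blast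
    have "meval a m = (\<Prod>i\<in>U. of_bool (f i = (p i, q i)))"
      unfolding f(2) meval_sum[OF assms(2)] meval_single
    proof (rule prod.cong)
      fix i assume "i \<in> U"
      then show "a (i, f i) = of_bool (f i = (p i, q i))"
        using f(1) a[of i "fst (f i)" "snd (f i)"] by (cases "f i") auto
    qed simp
    also have "\<dots> = of_bool (\<forall>i\<in>U. f i = (p i, q i))"
      using assms(2) by (induction U rule: finite_induct) auto
    also have "(\<forall>i\<in>U. f i = (p i, q i)) \<longleftrightarrow> m = ?m"
      using single_edge_sum_inj[OF assms(2), of f "\<lambda>i. (p i, q i)"] f(2) by auto
    finally show ?thesis .
  qed
  then have "ceval a d = (\<Sum>m\<in>keys d. lookup d m * of_bool (m = ?m))"
    by (simp add: ceval_superset[of "keys d"])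
  also have "\<dots> = lookup d ?m" by (simp add: in_keys_iff if_distrib[of "\<lambda>x. _ * x"] of_bool_def cong: if_cong)
  finally show ?thesis .
qed

definition edge_indicator :: "(nat \<Rightarrow> nat) \<Rightarrow> (nat \<Rightarrow> nat) \<Rightarrow> cvar \<Rightarrow> 'a::comm_ring_1" where
  "edge_indicator p q = (\<lambda>(k, i, j). of_bool (p k = i \<and> q k = j))"

text \<open>A plain function in place of a quasi-polynomial, so that differences can be formed word
  by word.\<close>

definition multilinear_family :: "nat \<Rightarrow> (nat list \<Rightarrow> 'a::comm_ring_1 cpoly) \<Rightarrow> bool" where
  "multilinear_family n D \<longleftrightarrow> (\<forall>w. if w \<in> words n then multilinear_in n ({..<n} - set w) (D w) else D w = 0)"

lemma multilinear_iff_family: "multilinear n P \<longleftrightarrow> multilinear_family n (lookup P)"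
  unfolding multilinear_def multilinear_family_def multilinear_in_def words_def
  by (auto simp: in_keys_iff)

lemma multilinear_family_local:
  assumes D: "multilinear_family n D" and w: "w \<in> words n"
    and pq: "\<And>k. k < n \<Longrightarrow> k \<notin> set w \<Longrightarrow> p k = p' k \<and> q k = q' k"
  shows "ceval (edge_indicator p q) (D w) = ceval (edge_indicator p' q') (D w)"
proof -
  have m: "multilinear_in n ({..<n} - set w) (D w)" using D w by (auto simp: multilinear_family_def)
  show ?thesis
    by (subst (1 2) ceval_multilinear_in[OF m])
      (auto simp: edge_indicator_def pq intro!: arg_cong[of _ _ "lookup (D w)"] sum.cong)
qed

text \<open>Each monomial of a coefficient is detected by the matrix units at the entries it
  picks.\<close>

lemma multilinear_family_eq_0:
  assumes D: "multilinear_family n D"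
    and z: "\<And>w p q. w \<in> words n \<Longrightarrow> (\<And>k. k < n \<Longrightarrow> p k < n) \<Longrightarrow> (\<And>k. k < n \<Longrightarrow> q k < n) \<Longrightarrow> ceval (edge_indicator p q) (D w) = 0"
  shows "D w = 0"
proof (rule ccontr)
  assume "D w \<noteq> 0"
  with D have w: "w \<in> words n" and m: "multilinear_in n ({..<n} - set w) (D w)"
    by (auto simp: multilinear_family_def split: if_splits)
  from \<open>D w \<noteq> 0\<close> obtain x where x: "x \<in> keys (D w)" by (metis keys_eq_empty equals0I)
  then obtain f where f: "\<forall>i\<in>{..<n} - set w. f i \<in> {..<n} \<times> {..<n}" "x = (\<Sum>i\<in>{..<n} - set w. single (i, f i) 1)"
    using m unfolding multilinear_in_def by blast
  \<comment> \<open>Letters of \<open>w\<close> do not occur in the monomial; the default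
    \<open>k\<close> keeps their ends below \<open>n\<close>.\<close>
  define p where "p = (\<lambda>k. if k < n \<and> k \<notin> set w then fst (f k) else k)"
  define q where "q = (\<lambda>k. if k < n \<and> k \<notin> set w then snd (f k) else k)"
  have "x = (\<Sum>i\<in>{..<n} - set w. single (i, p i, q i) 1)"
    unfolding f(2) by (intro sum.cong) (auto simp: p_def q_def)
  moreover have "ceval (edge_indicator p q) (D w) = 0"
    using f(1) by (intro z w) (auto simp: p_def q_def mem_Times_iff)
  ultimately have "lookup (D w) x = 0"
    using ceval_multilinear_in[OF m, of "edge_indicator p q" p q] by (simp add: edge_indicator_def)
  with x show False by (simp add: in_keys_iff)
qed

section \<open>The Cayley--Hamilton polynomial\<close>

definition edge_mat :: "nat \<Rightarrow> (nat \<Rightarrow> nat) \<Rightarrow> (nat \<Rightarrow> nat) \<Rightarrow> nat \<Rightarrow> 'a::comm_ring_1 mat" where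
  "edge_mat n p q k = mat n n (\<lambda>(i, j). of_bool (p k = i \<and> q k = j))"

text \<open>A product of matrix units is nonzero only if consecutive indices match, that is, if the
  edges form a trail.\<close>

lemma wprod_edge_mat:
  assumes "set w \<subseteq> {..<n}" "\<And>k. k < n \<Longrightarrow> q k < n"
  shows "(wprod n (edge_mat n p q) w :: 'a::comm_ring_1 mat) \<in> carrier_mat n n \<and> (\<forall>i<n. \<forall>j<n.
    wprod n (edge_mat n p q) w $$ (i, j) = (of_bool (trail p q i w j) :: 'a))"
  using assms(1)
proof (induction w)
  case Nil
  then show ?case by (auto simp: wprod_def)
next
  case (Cons k w)
  let ?M = "wprod n (edge_mat n p q) w :: 'a mat"
  have M: "?M $$ (i, j) = of_bool (trail p q i w j)" if "i < n" "j < n" for i j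
    using Cons that by auto
  have q: "q k < n" using Cons.prems assms by auto
  have C: "?M \<in> carrier_mat n n" using Cons by auto
  let ?E = "edge_mat n p q k :: 'a mat"
  have eq: "wprod n (edge_mat n p q) (k # w) = ?E * ?M" by (simp add: wprod_def)
  have E: "?E \<in> carrier_mat n n" by (simp add: edge_mat_def)
  have "(?E * ?M) $$ (i, j) = of_bool (trail p q i (k # w) j)" if "i < n" "j < n" for i j
  proof -
    have "(?E * ?M) $$ (i, j) = (\<Sum>l<n. ?E $$ (i, l) * ?M $$ (l, j))"
      using that C E by (simp add: scalar_prod_def atLeast0LessThan)
    \<comment> \<open>Only column \<open>q k\<close> of the matrix unit can be nonzero, and
      \<open>q k < n\<close> puts it into the range of the sum.\<close>
    also have "\<dots> = (\<Sum>l<n. if l = q k then of_bool (p k = i) * ?M $$ (l, j) else 0)"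
      using that by (intro sum.cong) (auto simp: edge_mat_def)
    also have "\<dots> = of_bool (trail p q i (k # w) j)"
      using q that M by (simp add: sum.delta)
    finally show ?thesis .
  qed
  with C E show ?case unfolding eq by auto
qed

text \<open>This is the entry \<open>(i, j)\<close> of the evaluation of \<open>P\<close> at matrix
  units.\<close>

lemma quasi_identity_trails:
  assumes P: "multilinear n P" "quasi_identity n P"
    and q: "\<And>k. k < n \<Longrightarrow> q k < n" and ij: "i < n" "j < n"
  shows "(\<Sum>w\<in>{w \<in> words n. trail p q i w j}. ceval (edge_indicator p q) (lookup P w)) = 0"
proof -
  have fam: "multilinear_family n (lookup P)" using P by (simp add: multilinear_iff_family)
  let ?A = "edge_mat n p q :: nat \<Rightarrow> 'a mat"
  have kw: "keys P \<subseteq> words n"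
    using fam by (auto simp: multilinear_family_def in_keys_iff split: if_splits)
  have ce: "ceval (\<lambda>(k, i, j). ?A k $$ (i, j)) (lookup P w) = ceval (edge_indicator p q) (lookup P w)"
    if "w \<in> words n" for w
  proof -
    have m: "multilinear_in n ({..<n} - set w) (lookup P w)"
      using fam that by (auto simp: multilinear_family_def)
    show ?thesis
      by (subst (1 2) ceval_multilinear_in[OF m, where p = p and q = q])
        (auto simp: edge_mat_def edge_indicator_def)
  qed
  have "?A k \<in> carrier_mat n n" for k by (simp add: edge_mat_def)
  then have "qeval n ?A P = 0\<^sub>m n n" using P(2) unfolding quasi_identity_def by blast
  then have "0 = qeval n ?A P $$ (i, j)" using ij by simp
  also have "\<dots> = (\<Sum>w\<in>keys P. ceval (\<lambda>(k, i, j). ?A k $$ (i, j)) (lookup P w) * wprod n ?A w $$ (i, j))"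
    using ij by (simp add: qeval_def)
  also have "\<dots> = (\<Sum>w\<in>keys P. ceval (edge_indicator p q) (lookup P w) * of_bool (trail p q i w j))"
  proof (rule sum.cong)
    fix w assume "w \<in> keys P"
    then have w: "w \<in> words n" using kw by blast
    then have "set w \<subseteq> {..<n}" by (simp add: words_def)
    from wprod_edge_mat[of w n q p, OF this q] ij
    have "wprod n ?A w $$ (i, j) = of_bool (trail p q i w j)" by blast
    with ce[OF w] show "ceval (\<lambda>(k, i, j). ?A k $$ (i, j)) (lookup P w) * wprod n ?A w $$ (i, j) =
      ceval (edge_indicator p q) (lookup P w) * of_bool (trail p q i w j)" by simp
  qed simp
  also have "\<dots> = (\<Sum>w\<in>words n. ceval (edge_indicator p q) (lookup P w) * of_bool (trail p q i w j))"
    using kw by (intro sum.mono_neutral_left) (auto simp: finite_words in_keys_iff)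
  also have "\<dots> = (\<Sum>w\<in>{w \<in> words n. trail p q i w j}. ceval (edge_indicator p q) (lookup P w))"
    by (intro sum.mono_neutral_cong_right) (auto simp: finite_words)
  finally show ?thesis by simp
qed

section \<open>Cycles of permutations, identified with the library notion
  \<open>support\<close>\<close>

lemma cyc_support:
  assumes "permutation \<sigma>"
  shows "cyc \<sigma> x = set (support \<sigma> x)" "cyc_list \<sigma> x = support \<sigma> x"
proof -
  show c: "cyc \<sigma> x = set (support \<sigma> x)"
    unfolding support_set[OF assms] cyc_def by auto
  have "card (cyc \<sigma> x) = least_power \<sigma> x"
    unfolding c using distinct_card[OF cycle_of_permutation[OF assms]] by simp
  then show "cyc_list \<sigma> x = support \<sigma> x" by (simp add: cyc_list_def)
qed

lemma cyc_list_props: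
  assumes "permutation \<sigma>"
  shows "distinct (cyc_list \<sigma> x)" "set (cyc_list \<sigma> x) = cyc \<sigma> x" "cyc_list \<sigma> x \<noteq> []"
    "hd (cyc_list \<sigma> x) = x"
  using cycle_of_permutation[OF assms] least_power_of_permutation(2)[OF assms, of x]
  by (auto simp: cyc_support[OF assms] hd_map)

lemma cyc_list_step:
  assumes "permutation \<sigma>" "j < length (cyc_list \<sigma> x)"
  shows "\<sigma> (cyc_list \<sigma> x ! j) = cyc_list \<sigma> x ! (Suc j mod length (cyc_list \<sigma> x))"
proof -
  have L: "(\<sigma> ^^ least_power \<sigma> x) x = x" "least_power \<sigma> x > 0"
    using least_power_of_permutation[OF assms(1)] by auto
  show ?thesis
  proof (cases "Suc j = least_power \<sigma> x")
    case True
    then have "\<sigma> ((\<sigma> ^^ j) x) = x" using L by (metis funpow.simps(2) o_apply)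
    with True L assms show ?thesis by (simp add: cyc_support)
  next
    case False
    then show ?thesis using assms by (simp add: cyc_support)
  qed
qed

lemma mem_cyc_self: "x \<in> cyc \<sigma> x"
  unfolding cyc_def by (rule CollectI, rule exI[of _ 0]) simp

lemma cyc_eq:
  assumes "permutation \<sigma>" "y \<in> cyc \<sigma> x"
  shows "cyc \<sigma> y = cyc \<sigma> x"
  using disjoint_support[OF assms(1)] assms(2) mem_cyc_self[of y \<sigma>]
  unfolding cyc_support(1)[OF assms(1)] disjoint_def by blast

lemma cyc_subset:
  assumes "\<sigma> permutes S" "x \<in> S"
  shows "cyc \<sigma> x \<subseteq> S"
  using permutes_in_image[OF permutes_funpow[OF assms(1)]] assms(2) by (auto simp: cyc_def)

section \<open>Values of traces and of \<open>phi\<close> at matrix units\<close>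

lemma prod_of_bool: "finite S \<Longrightarrow> (\<Prod>x\<in>S. of_bool (R x)) = (of_bool (\<forall>x\<in>S. R x) :: 'a::comm_ring_1)"
  by (induction S rule: finite_induct) auto

text \<open>In the sum over index functions only \<open>a j = p (ks ! j)\<close> can contribute, and
  it does so if the edges close up cyclically.\<close>

lemma ceval_trp:
  assumes "\<And>k. k \<in> set ks \<Longrightarrow> p k < n"
  shows "ceval (edge_indicator p q) (trp n ks) =
    (of_bool (\<forall>j<length ks. q (ks ! j) = p (ks ! (Suc j mod length ks))) :: 'a::comm_ring_1)"
proof -
  let ?L = "length ks"
  let ?b = "restrict (\<lambda>j. p (ks ! j)) {..<?L}"
  let ?R = "\<forall>j<?L. q (ks ! j) = p (ks ! (Suc j mod ?L))"
  have "ceval (edge_indicator p q :: cvar \<Rightarrow> 'a) (trp n ks) = (\<Sum>a\<in>{..<?L} \<rightarrow>\<^sub>E {..<n}.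
      of_bool (\<forall>j\<in>{..<?L}. p (ks ! j) = a j \<and> q (ks ! j) = a (Suc j mod ?L)))"
    by (simp add: trp_def ceval_sum ceval_prod edge_indicator_def prod_of_bool)
  also have "\<dots> = (\<Sum>a\<in>{..<?L} \<rightarrow>\<^sub>E {..<n}. if a = ?b then of_bool ?R else 0)"
  proof (rule sum.cong)
    fix a assume a: "a \<in> {..<?L} \<rightarrow>\<^sub>E {..<n}"
    have m: "Suc j mod ?L < ?L" if "j < ?L" for j
      using that by (intro mod_less_divisor) linarith
    have "a = ?b \<longleftrightarrow> (\<forall>j<?L. p (ks ! j) = a j)"
      using a by (auto simp: PiE_iff extensional_def fun_eq_iff)
    with m show "of_bool (\<forall>j\<in>{..<?L}. p (ks ! j) = a j \<and> q (ks ! j) = a (Suc j mod ?L)) =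
        (if a = ?b then of_bool ?R else (0::'a))"
      by (auto simp: of_bool_def)
  qed simp
  also have "?b \<in> {..<?L} \<rightarrow>\<^sub>E {..<n}" using assms by auto
  then have "(\<Sum>a\<in>{..<?L} \<rightarrow>\<^sub>E {..<n}. if a = ?b then of_bool ?R else 0) = (of_bool ?R :: 'a)"
    by (subst sum.delta) (auto simp: finite_PiE)
  finally show ?thesis .
qed

lemma multilinear_in_trp:
  assumes "distinct ks"
  shows "multilinear_in n (set ks) (trp n ks)"
proof -
  have "multilinear_in n (\<Union>j<length ks. {ks ! j})
      (\<Prod>j<length ks. cvarp (ks ! j, a j, a ((j + 1) mod length ks)) :: 'a cpoly)"
    if "a \<in> {..<length ks} \<rightarrow>\<^sub>E {..<n}" for a
  proof (rule multilinear_in_prod)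
    fix j assume "j \<in> {..<length ks}"
    moreover from this have "(j + 1) mod length ks < length ks" by (intro mod_less_divisor) auto
    ultimately show "multilinear_in n {ks ! j} (cvarp (ks ! j, a j, a ((j + 1) mod length ks)) :: 'a cpoly)"
      using that by (intro multilinear_in_cvarp) auto
  qed (use assms in \<open>auto simp: nth_eq_iff_index_eq\<close>)
  moreover have "(\<Union>j<length ks. {ks ! j}) = set ks" by (auto simp: set_conv_nth)
  ultimately show ?thesis unfolding trp_def by (auto intro: multilinear_in_sum)
qed

text \<open>Applying \<open>\<sigma>\<close> shifts its cycle list cyclically. This brings the
  conditions from traces and from closed trails into the same form.\<close>

lemma all_cyc_list_iff:
  assumes "permutation \<sigma>"
  shows "(\<forall>j<length (cyc_list \<sigma> x). R (cyc_list \<sigma> x ! j) (cyc_list \<sigma> x ! (Suc j mod length (cyc_list \<sigma> x))))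
    \<longleftrightarrow> (\<forall>y\<in>cyc \<sigma> x. R y (\<sigma> y))"
  unfolding cyc_list_props(2)[OF assms, symmetric] all_set_conv_all_nth
  using cyc_list_step[OF assms] by (auto cong: imp_cong)

definition phi_word :: "nat \<Rightarrow> (nat \<Rightarrow> nat) \<Rightarrow> nat list" where
  "phi_word n \<sigma> = tl (cyc_list \<sigma> n)"

definition phi_coeff :: "nat \<Rightarrow> (nat \<Rightarrow> nat) \<Rightarrow> 'a::comm_ring_1 cpoly" where
  "phi_coeff n \<sigma> = (\<Prod>Z\<in>{cyc \<sigma> x | x. x < n \<and> x \<notin> cyc \<sigma> n}. trp n (cyc_list \<sigma> (Min Z)))"

lemma lookup_Qn: "lookup (Qn n) w =
  (\<Sum>\<sigma>\<in>{\<sigma>. \<sigma> permutes {..n}}. of_int (sign \<sigma>) * (if phi_word n \<sigma> = w then phi_coeff n \<sigma> else 0))"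
  unfolding Qn_def lookup_sum
  by (intro sum.cong) (auto simp: phi_def phi_word_def phi_coeff_def lookup_single Poly_Mapping.map.rep_eq when_def)

context
  fixes n :: nat and \<sigma> :: "nat \<Rightarrow> nat"
  assumes \<sigma>: "\<sigma> permutes {..n}"
begin

lemma is_permutation: "permutation \<sigma>"
  using \<sigma> permutation_permutes by blast

lemma cyc_list_phi_word: "cyc_list \<sigma> n = n # phi_word n \<sigma>"
  using cyc_list_props(3,4)[OF is_permutation, of n] unfolding phi_word_def by (metis list.collapse)

lemma set_phi_word: "set (phi_word n \<sigma>) = cyc \<sigma> n - {n}" "distinct (phi_word n \<sigma>)"
  using cyc_list_props(1,2)[OF is_permutation, of n] unfolding cyc_list_phi_word by auto

lemma phi_word_words: "phi_word n \<sigma> \<in> words n"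
  using set_phi_word cyc_subset[OF \<sigma>, of n] by (force simp: words_def)

lemma other_cycles:
  assumes "Z \<in> {cyc \<sigma> x | x. x < n \<and> x \<notin> cyc \<sigma> n}"
  shows "cyc \<sigma> (Min Z) = Z" "finite Z" "Z \<subseteq> {..<n} - cyc \<sigma> n"
proof -
  obtain x where x: "Z = cyc \<sigma> x" "x < n" "x \<notin> cyc \<sigma> n" using assms by blast
  have "Z \<subseteq> {..n}" using cyc_subset[OF \<sigma>, of x] x by simp
  then show fin: "finite Z" by (rule finite_subset) simp
  have "Min Z \<in> Z" using fin mem_cyc_self[of x \<sigma>] x by (intro Min_in) auto
  then show "cyc \<sigma> (Min Z) = Z" using cyc_eq[OF is_permutation] x by simp
  have "y \<notin> cyc \<sigma> n" if "y \<in> Z" for y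
    using cyc_eq[OF is_permutation, of y x] cyc_eq[OF is_permutation, of y n] mem_cyc_self[of x \<sigma>] x that by auto
  with \<open>Z \<subseteq> {..n}\<close> mem_cyc_self[of n \<sigma>] show "Z \<subseteq> {..<n} - cyc \<sigma> n" by (auto simp: order_le_less)
qed

lemma finite_other_cycles: "finite {cyc \<sigma> x | x. x < n \<and> x \<notin> cyc \<sigma> n}"
  by (rule finite_subset[of _ "cyc \<sigma> ` {..<n}"]) auto

lemma Union_other_cycles: "\<Union> {cyc \<sigma> x | x. x < n \<and> x \<notin> cyc \<sigma> n} = {..<n} - cyc \<sigma> n"
proof
  show "\<Union> {cyc \<sigma> x | x. x < n \<and> x \<notin> cyc \<sigma> n} \<subseteq> {..<n} - cyc \<sigma> n"
    using other_cycles(3) by (meson Union_least)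
  show "{..<n} - cyc \<sigma> n \<subseteq> \<Union> {cyc \<sigma> x | x. x < n \<and> x \<notin> cyc \<sigma> n}"
    using mem_cyc_self[of _ \<sigma>] by fastforce
qed

lemma disjoint_other_cycles:
  assumes "Y \<in> {cyc \<sigma> x | x. x < n \<and> x \<notin> cyc \<sigma> n}" "Z \<in> {cyc \<sigma> x | x. x < n \<and> x \<notin> cyc \<sigma> n}" "Y \<noteq> Z"
  shows "Y \<inter> Z = {}"
  using assms cyc_eq[OF is_permutation] by blast

lemma multilinear_in_phi_coeff:
  "multilinear_in n ({..<n} - set (phi_word n \<sigma>)) (phi_coeff n \<sigma> :: 'a::comm_ring_1 cpoly)"
proof -
  have "multilinear_in n (\<Union>Z\<in>{cyc \<sigma> x | x. x < n \<and> x \<notin> cyc \<sigma> n}. Z) (phi_coeff n \<sigma> :: 'a cpoly)"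
    unfolding phi_coeff_def
  proof (rule multilinear_in_prod[OF finite_other_cycles])
    fix Z assume "Z \<in> {cyc \<sigma> x | x. x < n \<and> x \<notin> cyc \<sigma> n}"
    from other_cycles(1)[OF this] cyc_list_props(1,2)[OF is_permutation, of "Min Z"]
    show "multilinear_in n Z (trp n (cyc_list \<sigma> (Min Z)) :: 'a cpoly)"
      using multilinear_in_trp by metis
  qed (use other_cycles(2) disjoint_other_cycles in blast)+
  moreover have "{..<n} - set (phi_word n \<sigma>) = {..<n} - cyc \<sigma> n"
    using set_phi_word by auto
  ultimately show ?thesis using Union_other_cycles by simp
qed

text \<open>Each trace factor tests the edges on its own cycle, and these cycles cover exactly the
  numbers below \<open>n\<close> off the cycle of \<open>n\<close>.\<close>

lemma ceval_phi_coeff: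
  assumes p: "\<And>k. k < n \<Longrightarrow> p k < n"
  shows "ceval (edge_indicator p q :: cvar \<Rightarrow> 'a::comm_ring_1) (phi_coeff n \<sigma>) = of_bool (\<forall>y\<in>{..<n} - cyc \<sigma> n. q y = p (\<sigma> y))"
proof -
  have "ceval (edge_indicator p q :: cvar \<Rightarrow> 'a) (phi_coeff n \<sigma>) =
    (\<Prod>Z\<in>{cyc \<sigma> x | x. x < n \<and> x \<notin> cyc \<sigma> n}. of_bool (\<forall>y\<in>Z. q y = p (\<sigma> y)))"
    unfolding phi_coeff_def ceval_prod
  proof (rule prod.cong)
    fix Z assume Z: "Z \<in> {cyc \<sigma> x | x. x < n \<and> x \<notin> cyc \<sigma> n}"
    note oc = other_cycles[OF Z]
    have "set (cyc_list \<sigma> (Min Z)) = Z" using oc cyc_list_props(2)[OF is_permutation] by simp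
    then show "ceval (edge_indicator p q :: cvar \<Rightarrow> 'a) (trp n (cyc_list \<sigma> (Min Z))) = of_bool (\<forall>y\<in>Z. q y = p (\<sigma> y))"
      using all_cyc_list_iff[OF is_permutation, of "Min Z" "\<lambda>y z. q y = p z"] oc p by (subst ceval_trp) auto
  qed simp
  also have "\<dots> = of_bool (\<forall>Z\<in>{cyc \<sigma> x | x. x < n \<and> x \<notin> cyc \<sigma> n}. \<forall>y\<in>Z. q y = p (\<sigma> y))"
    by (rule prod_of_bool[OF finite_other_cycles])
  also have "(\<forall>Z\<in>{cyc \<sigma> x | x. x < n \<and> x \<notin> cyc \<sigma> n}. \<forall>y\<in>Z. q y = p (\<sigma> y)) \<longleftrightarrow>
    (\<forall>y\<in>{..<n} - cyc \<sigma> n. q y = p (\<sigma> y))"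
    unfolding Union_other_cycles[symmetric] by blast
  finally show ?thesis .
qed

end

section \<open>Closed trails, and the vanishing determinant behind \<open>Qn\<close>\<close>

lemma trail_Cons_iff:
  "trail p q (q k) w (p k) \<longleftrightarrow>
    (\<forall>j<length (k # w). q ((k # w) ! j) = p ((k # w) ! (Suc j mod length (k # w))))"
proof -
  \<comment> \<open>The end is generalised from \<open>p k\<close> to \<open>l\<close> because the
    induction changes \<open>k\<close>.\<close>
  have "trail p q (q k) w l \<longleftrightarrow> (\<forall>j<length w. q ((k # w) ! j) = p (w ! j)) \<and> q ((k # w) ! length w) = l" for l
    by (induction w arbitrary: k) (auto simp: less_Suc_eq_0_disj)
  then have "trail p q (q k) w (p k) \<longleftrightarrow>
    (\<forall>j<length w. q ((k # w) ! j) = p (w ! j)) \<and> q ((k # w) ! length w) = p k" .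
  moreover have "(k # w) ! (Suc j mod Suc (length w)) = w ! j" if "j < length w" for j
    using that by simp
  ultimately show ?thesis by (auto simp: less_Suc_eq simp del: nth_Cons_Suc mod_Suc_eq)
qed

lemma trail_cong:
  assumes "\<And>k. k \<in> set w \<Longrightarrow> p k = p' k \<and> q k = q' k"
  shows "trail p q i w j \<longleftrightarrow> trail p' q' i w j"
  using assms by (induction w arbitrary: i) auto

text \<open>The sum is the Leibniz expansion of a determinant of size \<open>n + 1\<close>. The
  \<open>n + 1\<close> targets \<open>q k\<close> lie among \<open>n\<close> vertices, so two rows
  agree.\<close>

lemma alternating_edge_sum_zero:
  fixes p q :: "nat \<Rightarrow> nat"
  assumes "\<And>k. k \<le> n \<Longrightarrow> q k < n"
  shows "(\<Sum>\<sigma>\<in>{\<sigma>. \<sigma> permutes {..n}}. of_int (sign \<sigma>) * of_bool (\<forall>y\<le>n. q y = p (\<sigma> y))) = (0::'a::comm_ring_1)"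
proof -
  let ?A = "mat (Suc n) (Suc n) (\<lambda>(a, b). of_bool (q a = p b)) :: 'a mat"
  have set_n: "{0..<Suc n} = {..n}" by auto
  have "\<not> inj_on q {..n}"
    using card_inj_on_le[of q "{..n}" "{..<n}"] assms by auto
  then obtain x y where xy: "x \<le> n" "y \<le> n" "x \<noteq> y" "q x = q y" by (auto simp: inj_on_def)
  have "det ?A = 0"
    using xy by (intro det_identical_rows[of ?A "Suc n" x y]) auto
  moreover have "det ?A = (\<Sum>\<sigma> | \<sigma> permutes {0..<Suc n}. of_int (sign \<sigma>) * (\<Prod>i = 0..<Suc n. ?A $$ (i, \<sigma> i)))"
    by (rule det_def') simp
  moreover have "(\<Prod>i = 0..<Suc n. ?A $$ (i, \<sigma> i)) = of_bool (\<forall>y\<le>n. q y = p (\<sigma> y))"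
    if "\<sigma> permutes {..n}" for \<sigma>
  proof -
    have "\<sigma> i \<le> n" if "i \<le> n" for i using permutes_in_image[OF \<open>\<sigma> permutes {..n}\<close>] that by simp
    then have "?A $$ (i, \<sigma> i) = of_bool (q i = p (\<sigma> i))" if "i \<in> {..n}" for i
      using that by (simp add: less_Suc_eq_le)
    then have "(\<Prod>i\<in>{..n}. ?A $$ (i, \<sigma> i)) = (\<Prod>i\<in>{..n}. of_bool (q i = p (\<sigma> i)))"
      by (rule prod.cong[OF refl])
    then show ?thesis by (simp add: prod_of_bool Ball_def set_n del: prod.op_ivl_Suc)
  qed
  ultimately show ?thesis unfolding set_n by simp
qed

text \<open>With the additional edge \<open>n\<close> from \<open>j\<close> to \<open>i\<close>,
  being a trail becomes the same condition on the cycle of \<open>n\<close> as the traces impose on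
  the other cycles. Together they give the alternating sum over all permutations.\<close>

lemma Qn_trails:
  assumes p: "\<And>k. k < n \<Longrightarrow> p k < n" and q: "\<And>k. k < n \<Longrightarrow> q k < n" and ij: "i < n" "j < n"
  shows "(\<Sum>w\<in>{w \<in> words n. trail p q i w j}. ceval (edge_indicator p q) (lookup (Qn n) w)) = (0::'a::comm_ring_1)"
proof -
  let ?S = "{\<sigma>. \<sigma> permutes {..n}}"
  let ?e = "edge_indicator p q :: cvar \<Rightarrow> 'a"
  let ?T = "{w \<in> words n. trail p q i w j}"
  define p' where "p' = p(n := j)"
  define q' where "q' = q(n := i)"
  have "(\<Sum>w\<in>?T. ceval ?e (lookup (Qn n) w)) =
    (\<Sum>w\<in>?T. \<Sum>\<sigma>\<in>?S. if phi_word n \<sigma> = w then of_int (sign \<sigma>) * ceval ?e (phi_coeff n \<sigma>) else 0)"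
    by (auto simp: lookup_Qn ceval_sum intro!: sum.cong)
  also have "\<dots> = (\<Sum>\<sigma>\<in>?S. \<Sum>w\<in>?T. if phi_word n \<sigma> = w then of_int (sign \<sigma>) * ceval ?e (phi_coeff n \<sigma>) else 0)"
    by (rule sum.swap)
  also have "\<dots> = (\<Sum>\<sigma>\<in>?S. of_int (sign \<sigma>) * of_bool (\<forall>y\<le>n. q' y = p' (\<sigma> y)))"
  proof (rule sum.cong)
    fix \<sigma> assume "\<sigma> \<in> ?S"
    then have \<sigma>: "\<sigma> permutes {..n}" by simp
    have sw: "set (phi_word n \<sigma>) \<subseteq> {..<n}" using phi_word_words[OF \<sigma>] by (simp add: words_def)
    have "trail p q i (phi_word n \<sigma>) j \<longleftrightarrow> trail p' q' (q' n) (phi_word n \<sigma>) (p' n)"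
      using sw by (subst trail_cong[of _ p p' q q']) (auto simp: p'_def q'_def)
    also have "\<dots> \<longleftrightarrow> (\<forall>y\<in>cyc \<sigma> n. q' y = p' (\<sigma> y))"
      unfolding trail_Cons_iff cyc_list_phi_word[OF \<sigma>, symmetric]
      by (rule all_cyc_list_iff[OF is_permutation[OF \<sigma>], of n "\<lambda>y z. q' y = p' z"])
    finally have t: "trail p q i (phi_word n \<sigma>) j \<longleftrightarrow> (\<forall>y\<in>cyc \<sigma> n. q' y = p' (\<sigma> y))" .
    \<comment> \<open>Off the cycle of \<open>n\<close>, neither \<open>y\<close> nor
      \<open>\<sigma> y\<close> is \<open>n\<close>, so \<open>p'\<close> and \<open>q'\<close> act
      there as \<open>p\<close> and \<open>q\<close>.\<close>
    have "\<sigma> y \<noteq> n" if "y \<in> {..<n} - cyc \<sigma> n" for y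
    proof
      assume "\<sigma> y = n"
      then have "n \<in> cyc \<sigma> y" unfolding cyc_def by (intro CollectI exI[of _ 1]) simp
      with cyc_eq[OF is_permutation[OF \<sigma>], of n y] mem_cyc_self[of y \<sigma>] that show False by auto
    qed
    then have c: "(\<forall>y\<in>{..<n} - cyc \<sigma> n. q y = p (\<sigma> y)) \<longleftrightarrow> (\<forall>y\<in>{..<n} - cyc \<sigma> n. q' y = p' (\<sigma> y))"
      by (auto simp: p'_def q'_def)
    have "{..n} = cyc \<sigma> n \<union> ({..<n} - cyc \<sigma> n)"
      using cyc_subset[OF \<sigma>, of n] mem_cyc_self[of n \<sigma>] by (auto simp: order_le_less)
    then have all: "(\<forall>y\<le>n. q' y = p' (\<sigma> y)) \<longleftrightarrow>
        (\<forall>y\<in>cyc \<sigma> n. q' y = p' (\<sigma> y)) \<and> (\<forall>y\<in>{..<n} - cyc \<sigma> n. q' y = p' (\<sigma> y))"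
      by (metis Un_iff atMost_iff)
    have "(\<Sum>w\<in>?T. if phi_word n \<sigma> = w then of_int (sign \<sigma>) * ceval ?e (phi_coeff n \<sigma>) else 0) =
      of_int (sign \<sigma>) * ceval ?e (phi_coeff n \<sigma>) * of_bool (trail p q i (phi_word n \<sigma>) j)"
      using phi_word_words[OF \<sigma>] by (simp add: finite_words)
    also have "\<dots> = of_int (sign \<sigma>) * of_bool (\<forall>y\<le>n. q' y = p' (\<sigma> y))"
      by (simp add: ceval_phi_coeff[OF \<sigma> p] t c all)
    finally show "(\<Sum>w\<in>?T. if phi_word n \<sigma> = w then of_int (sign \<sigma>) * ceval ?e (phi_coeff n \<sigma>) else 0) =
      of_int (sign \<sigma>) * of_bool (\<forall>y\<le>n. q' y = p' (\<sigma> y))" .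
  qed simp
  also have "\<dots> = 0"
    using q ij by (intro alternating_edge_sum_zero) (auto simp: q'_def)
  finally show ?thesis .
qed

lemma multilinear_family_Qn: "multilinear_family n (lookup (Qn n :: 'a::comm_ring_1 qpoly))"
  unfolding multilinear_family_def
proof
  fix w
  show "if w \<in> words n then multilinear_in n ({..<n} - set w) (lookup (Qn n :: 'a qpoly) w) else lookup (Qn n :: 'a qpoly) w = 0"
  proof (cases "w \<in> words n")
    case True
    then show ?thesis
      using multilinear_in_phi_coeff
      by (auto simp: lookup_Qn intro!: multilinear_in_sum multilinear_in_sign)
  next
    case False
    then show ?thesis using phi_word_words by (auto simp: lookup_Qn intro!: sum.neutral)
  qed
qed

section \<open>The coefficient of \<open>Qn\<close> at the word \<open>[0..<n]\<close>\<close>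

definition rot :: "nat \<Rightarrow> nat \<Rightarrow> nat" where
  "rot n x = (if x < n then Suc x else if x = n then 0 else x)"

lemma rot_permutes: "rot n permutes {..n}"
proof (rule bij_imp_permutes)
  have "inj_on (rot n) {..n}" by (auto simp: inj_on_def rot_def)
  moreover have "rot n ` {..n} \<subseteq> {..n}" by (auto simp: rot_def)
  ultimately show "bij_betw (rot n) {..n} {..n}" by (simp add: bij_betw_def endo_inj_surj)
qed (auto simp: rot_def)

lemma cyc_rot: "cyc (rot n) n = {..n}"
proof
  show "cyc (rot n) n \<subseteq> {..n}" by (rule cyc_subset[OF rot_permutes]) simp
  have "(rot n ^^ Suc j) n = j" if "j \<le> n" for j
    using that by (induction j) (auto simp: rot_def)
  then show "{..n} \<subseteq> cyc (rot n) n" unfolding cyc_def by (metis (mono_tags, lifting) CollectI atMost_iff subsetI)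
qed

lemma phi_word_rot: "phi_word n (rot n) = [0..<n]"
proof -
  have "(rot n ^^ Suc j) n = j" if "j \<le> n" for j
    using that by (induction j) (auto simp: rot_def)
  then show ?thesis
    unfolding phi_word_def cyc_list_def cyc_rot
    by (auto simp: map_tl[symmetric] tl_upt intro!: nth_equalityI simp del: funpow.simps upt_Suc)
qed

text \<open>The word lists the cycle of \<open>n\<close>, which here is all of \<open>{..n}\<close>,
  so nothing of \<open>\<sigma>\<close> is left to choose.\<close>

lemma rot_unique:
  assumes "\<sigma> permutes {..n}" "phi_word n \<sigma> = [0..<n]"
  shows "\<sigma> = rot n"
proof
  fix x
  have l: "cyc_list \<sigma> n = n # [0..<n]" using cyc_list_phi_word[OF assms(1)] assms(2) by simp
  have step: "\<sigma> ((n # [0..<n]) ! j) = (n # [0..<n]) ! (Suc j mod Suc n)" if "j \<le> n" for j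
    using cyc_list_step[OF is_permutation[OF assms(1)], of j n] that unfolding l by simp
  consider "x < n" | "x = n" | "x > n" by linarith
  then show "\<sigma> x = rot n x"
  proof cases
    case 1
    then show ?thesis using step[of "Suc x"] by (cases "Suc x = n") (auto simp: rot_def)
  next
    case 2
    then show ?thesis using step[of 0] by (cases n) (auto simp: rot_def simp del: upt_Suc)
  next
    case 3
    then show ?thesis using permutes_not_in[OF assms(1), of x] by (auto simp: rot_def)
  qed
qed

text \<open>Only \<open>rot n\<close> contributes, and its product of traces is empty.\<close>

lemma lookup_Qn_full: "lookup (Qn n :: 'a::comm_ring_1 qpoly) [0..<n] = of_int (sign (rot n))"
proof -
  have "lookup (Qn n :: 'a qpoly) [0..<n] = (\<Sum>\<sigma>\<in>{rot n}. of_int (sign \<sigma>) * phi_coeff n \<sigma>)"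
    unfolding lookup_Qn using rot_permutes rot_unique
    by (intro sum.mono_neutral_cong_right) (auto simp: phi_word_rot finite_permutations)
  moreover have none: "{cyc (rot n) x | x. x < n \<and> x \<notin> cyc (rot n) n} = {}" by (auto simp: cyc_rot)
  have "phi_coeff n (rot n) = (1 :: 'a cpoly)" unfolding phi_coeff_def none by simp
  ultimately show ?thesis by simp
qed

theorem mainTheorem18:
  fixes n :: nat and P :: "'a::field_char_0 qpoly"
  assumes "multilinear n P" and "quasi_identity n P"
  shows "\<exists>c::'a. \<forall>w. Poly_Mapping.lookup P w = cconst c * Poly_Mapping.lookup (Qn n :: 'a qpoly) w"
proof -
  define s :: 'a where "s = of_int (sign (rot n))"
  have s: "s * s = 1" by (simp add: s_def sign_def)
  \<comment> \<open>As \<open>s\<close> is its own inverse, this \<open>c\<close> makes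
    \<open>P\<close> and \<open>c\<close> times \<open>Qn n\<close> agree at \<open>[0..<n]\<close>.
    The coefficient of a full word is constant, so the edges \<open>id\<close> are an arbitrary
    choice.\<close>
  define c where "c = s * ceval (edge_indicator id id) (lookup P [0..<n])"
  define D where "D w = lookup P w - cconst c * lookup (Qn n) w" for w
  define d where "d w p q = ceval (edge_indicator p q) (D w)" for w p q
  have famP: "multilinear_family n (lookup P)" using assms by (simp add: multilinear_iff_family)
  have D: "multilinear_family n D"
    using famP multilinear_family_Qn[of n, where 'a = 'a]
    unfolding multilinear_family_def D_def diff_conv_add_uminus
    by (auto intro!: multilinear_in_add multilinear_in_uminus multilinear_in_cconst_mult
        simp del: add_uminus_conv_diff)
  \<comment> \<open>The trail equations are linear, so they pass from \<open>P\<close> and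
    \<open>Qn n\<close> to the difference \<open>D\<close>.\<close>
  interpret trail_system n d
  proof
    show "d w p q = d w p' q'" if "w \<in> words n" "\<And>k. k < n \<Longrightarrow> k \<notin> set w \<Longrightarrow> p k = p' k \<and> q k = q' k"
      for w p q p' q'
      using multilinear_family_local[OF D that] by (simp add: d_def)
    show "(\<Sum>w\<in>{w \<in> words n. trail p q i w j}. d w p q) = 0"
      if "\<And>k. k < n \<Longrightarrow> p k < n" "\<And>k. k < n \<Longrightarrow> q k < n" "i < n" "j < n" for p q i j
      using quasi_identity_trails[of n P q i j p, OF assms that(2-4)] Qn_trails[of n p q i j, OF that, where 'a = 'a]
      by (simp add: d_def D_def ceval_diff ceval_mult sum_subtractf sum_distrib_left[symmetric])
  qed
  have w0: "[0..<n] \<in> words n" by (auto simp: words_def)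
  \<comment> \<open>All full words share the coefficient at \<open>[0..<n]\<close>, which vanishes
    by the choice of \<open>c\<close>.\<close>
  have "d w p q = 0" if "w \<in> words n" "length w = n" for w p q
  proof -
    have "d w p q = d [0..<n] id id"
      using full_eq[OF that] coeff_local[OF w0, of p id q id] by simp
    also have "\<dots> = ceval (edge_indicator id id) (lookup P [0..<n]) - c * s"
      using ceval_sign[of "edge_indicator id id" "rot n" "1 :: 'a cpoly"]
      by (simp add: d_def D_def ceval_diff ceval_mult lookup_Qn_full s_def)
    also have "\<dots> = 0" using s by (simp add: c_def mult_ac)
    finally show ?thesis .
  qed
  then have "d w p q = 0" if "w \<in> words n" "\<And>k. k < n \<Longrightarrow> p k < n" "\<And>k. k < n \<Longrightarrow> q k < n" for w p q
    using zero_if_full_zero that by blast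
  then have "D w = 0" for w
    using multilinear_family_eq_0[OF D] by (simp add: d_def)
  then show ?thesis unfolding D_def by (auto intro!: exI[of _ c])
qed

end
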